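(* Let $n\geq 1$ and let $(\xi_1,\zeta_1),\ldots,(\xi_n,\zeta_n)$ be independent and identically distributed pairs of real random variables. Let $(F_u)_{u\in\mathbb{R}}$ be a family of cumulative distribution functions on $\mathbb{R}$ such that $u\mapsto F_u(x)$ is Borel measurable for every $x\in\mathbb{R}$, and such that $F_u(\cdot)$ is continuous for every $u\in\mathbb{R}$. Suppose that the conditional null hypothesis is true, i.e. for every $i=1,\ldots,n$ and every $x\in\mathbb{R}$, $$P(\xi_i\leq x\mid \zeta_i)=F_{\zeta_i}(x)\quad\text{almost surely}.$$ Let $$S_n=\sup_{x\in[0,1]}\left|\frac{1}{n}\sum_{i=1}^n \mathbf{1}_{[0,x]}\left(F_{\zeta_i}(\xi_i)\right)-x\right|.$$ Then $S_n$ is KS distributed, i.e. the law of $S_n$ is the Kolmogorov-Smirnov distribution with parameter $n$.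
   Context: $\mathbf{1}_A$ denotes the indicator function of a set $A$. The notation $F_{\zeta_i}(\xi_i)$ means the random variable obtained by evaluating $F_u(x)$ at $u=\zeta_i$, $x=\xi_i$. Kolmogorov-Smirnov (KS) distribution with parameter $n$: let $X_1,\ldots,X_n$ be independent real random variables with common continuous cumulative distribution function $F$, and let $$D_n=\sup_{x\in\mathbb{R}}\left|\frac{1}{n}\sum_{i=1}^n\mathbf{1}_{(-\infty,x]}(X_i)-F(x)\right|.$$ By a classical theorem of Kolmogorov the law of $D_n$ depends only on $n$ and not on the choice of the continuous $F$ (so one may take, for instance, $F$ to be the CDF of the uniform distribution on $[0,1]$); this law is called the KS distribution with parameter $n$. A random variable is called KS distributed (for the given $n$) if it has this law. *)

theory Defs
  imports "HOL-Probability.Probability"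
begin

text \<open>The statistic $D_n$ as a function of the sample \<open>X 1, \<dots>, X n\<close>, for the sample law
  \<open>\<nu>\<close> with cumulative distribution function \<^term>\<open>cdf \<nu>\<close>.\<close>

definition KS_statistic :: "real measure \<Rightarrow> nat \<Rightarrow> (nat \<Rightarrow> real) \<Rightarrow> real" where
  "KS_statistic \<nu> n X =
     (SUP x. \<bar>(1 / real n) * (\<Sum>i=1..n. indicator {..x} (X i)) - cdf \<nu> x\<bar>)"

text \<open>Independent real random variables with common law \<open>\<nu>\<close> have the product measure as joint law,
  so the law of $D_n$ can be computed on the product space.\<close>

definition KS_law :: "real measure \<Rightarrow> nat \<Rightarrow> real measure" where
  "KS_law \<nu> n = distr (\<Pi>\<^sub>M i\<in>{1..n}. \<nu>) borel (KS_statistic \<nu> n)"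

text \<open>By Kolmogorov's theorem \<^term>\<open>KS_law \<nu> n\<close> is the same for all \<open>\<nu>\<close> with continuous distribution
  function. Instead of singling out one such \<open>\<nu>\<close> (e.g. the uniform distribution), the law of \<open>Y\<close> is
  required to agree with \<^term>\<open>KS_law \<nu> n\<close> for all of them.\<close>

definition KS_distributed :: "'a measure \<Rightarrow> nat \<Rightarrow> ('a \<Rightarrow> real) \<Rightarrow> bool" where
  "KS_distributed M n Y \<longleftrightarrow>
     Y \<in> borel_measurable M \<and>
     (\<forall>\<nu>. real_distribution \<nu> \<and> continuous_on UNIV (cdf \<nu>) \<longrightarrow> distr M borel Y = KS_law \<nu> n)"

end

theory Submission
  imports Defs
begin

text \<open>
  Write \<open>U i = F (\<zeta> i) (\<xi> i)\<close>. The proof has two halves, which meet in the Kolmogorov-Smirnov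
  law of the uniform distribution on \<open>[0, 1]\<close>.

  First, each \<open>U i\<close> is uniform on \<open>[0, 1]\<close>. The null hypothesis determines the joint law of \<open>\<zeta> i\<close> and
  \<open>\<xi> i\<close>: draw \<open>u\<close> from the law of \<open>\<zeta> i\<close>, and then draw \<open>x\<close> from the distribution with distribution function
  \<open>F u\<close>. For every fixed \<open>u\<close> the second draw makes \<open>F u x\<close> uniform, by the probability integral
  transform for continuous distribution functions. Mixing over \<open>u\<close> therefore mixes copies of one and the
  same law. The transform is \<open>distr_cdf_eq_unif\<close> and its conditional form is
  \<open>conditional_probability_integral_transform\<close>. As the pairs are independent, so are the \<open>U i\<close>, and the
  statistic in question is the Kolmogorov-Smirnov statistic of a uniform sample.

  Second, Kolmogorov's theorem \<open>KS_law_distribution_free\<close> says that the law of the statistic is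
  the same for all continuous sample laws. It rests again on the integral transform: if \<open>Y\<close> is a sample
  from a law with continuous distribution function \<open>G\<close>, then \<open>G \<circ> Y\<close> is a uniform sample. Almost surely the
  statistic of \<open>Y\<close> equals the statistic of \<open>G \<circ> Y\<close>, because replacing \<open>Y i \<le> x\<close> by
  \<open>G (Y i) \<le> G x\<close> makes a difference only when \<open>Y i\<close> falls into an interval where \<open>G\<close>
  is constant. There are countably many maximal intervals of this kind, each of probability \<open>0\<close>.
\<close>

section \<open>Measurability of the Kolmogorov-Smirnov statistic\<close>

text \<open>If \<open>f x\<close> exceeded the supremum over the rationals, then so would \<open>f\<close> at all points slightly to
  the right of \<open>x\<close>, and some of these are rational. This turns the uncountable supremum in the
  statistic into a countable one, which is measurable.\<close>

lemma SUP_rationals_right_continuous: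
  fixes f :: "real \<Rightarrow> real"
  assumes rc: "\<And>x. continuous (at_right x) f" and bdd: "bdd_above (range f)"
  shows "(SUP x. f x) = (SUP q\<in>\<rat>. f q)"
proof (rule antisym)
  have bddQ: "bdd_above (f ` \<rat>)"
    using bdd by (rule bdd_above_mono) auto
  show "(SUP x. f x) \<le> (SUP q\<in>\<rat>. f q)"
  proof (rule cSUP_least)
    fix x :: real
    show "f x \<le> (SUP q\<in>\<rat>. f q)"
    proof (rule ccontr)
      assume "\<not> f x \<le> (SUP q\<in>\<rat>. f q)"
      then have "\<forall>\<^sub>F y in at_right x. f y > (SUP q\<in>\<rat>. f q)"
        using rc[of x] by (intro order_tendstoD(1)) (auto simp: continuous_within)
      then obtain b where b: "b > x" "\<And>y. x < y \<Longrightarrow> y < b \<Longrightarrow> f y > (SUP q\<in>\<rat>. f q)"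
        unfolding eventually_at_right_field by blast
      obtain q where q: "q \<in> \<rat>" "x < q" "q < b"
        using Rats_dense_in_real[OF b(1)] by blast
      then have "f q \<le> (SUP q\<in>\<rat>. f q)"
        by (intro cSUP_upper bddQ)
      with b(2)[of q] q show False by simp
    qed
  qed simp
  show "(SUP q\<in>\<rat>. f q) \<le> (SUP x. f x)"
    using bdd by (intro cSUP_mono) (auto intro: Rats_0)
qed

lemma continuous_at_right_indicator_atMost:
  fixes a x :: real
  shows "continuous (at_right x) (\<lambda>x. indicator {..x} a :: real)"
proof (cases "a \<le> x")
  case True
  then have "\<forall>\<^sub>F y in at_right x. (indicator {..y} a :: real) = indicator {..x} a"
    unfolding eventually_at_right_field by (intro exI[of _ "x + 1"]) (auto simp: indicator_def)
  then show ?thesis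
    unfolding continuous_within by (rule tendsto_eventually)
next
  case False
  then have "\<forall>\<^sub>F y in at_right x. (indicator {..y} a :: real) = indicator {..x} a"
    unfolding eventually_at_right_field by (intro exI[of _ a]) (auto simp: indicator_def)
  then show ?thesis
    unfolding continuous_within by (rule tendsto_eventually)
qed

lemma bdd_above_KS_deviation:
  assumes "real_distribution \<nu>"
  shows "bdd_above (range (\<lambda>x. \<bar>(1 / real n) * (\<Sum>i=1..n. indicator {..x} (X i)) - cdf \<nu> x\<bar>))"
proof (rule bdd_aboveI)
  interpret real_distribution \<nu> by fact
  fix y assume "y \<in> range (\<lambda>x. \<bar>(1 / real n) * (\<Sum>i=1..n. indicator {..x} (X i)) - cdf \<nu> x\<bar>)"
  then obtain x where y: "y = \<bar>(1 / real n) * (\<Sum>i=1..n. indicator {..x} (X i)) - cdf \<nu> x\<bar>"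
    by auto
  have "(\<Sum>i=1..n. indicator {..x} (X i)) \<le> (\<Sum>i=1..n. 1 :: real)"
    by (rule sum_mono) (simp add: indicator_def)
  moreover have "(\<Sum>i=1..n. indicator {..x} (X i)) \<ge> (0 :: real)"
    by (rule sum_nonneg) simp
  ultimately have "0 \<le> (1 / real n) * (\<Sum>i=1..n. indicator {..x} (X i))"
    "(1 / real n) * (\<Sum>i=1..n. indicator {..x} (X i)) \<le> 1"
    by (auto simp: divide_simps)
  with cdf_nonneg[of x] cdf_bounded_prob[of x] show "y \<le> 1"
    unfolding y by linarith
qed

lemma borel_measurable_KS_statistic:
  assumes \<nu>: "real_distribution \<nu>"
    and X: "\<And>i. i \<in> {1..n} \<Longrightarrow> X i \<in> borel_measurable M"
  shows "(\<lambda>\<omega>. KS_statistic \<nu> n (\<lambda>i. X i \<omega>)) \<in> borel_measurable M"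
proof -
  interpret real_distribution \<nu> by fact
  have ind: "(\<lambda>\<omega>. indicator {..x} (X i \<omega>) :: real) \<in> borel_measurable M" if "i \<in> {1..n}" for i x
    using X[OF that] by measurable
  have "KS_statistic \<nu> n Y =
      (SUP x\<in>\<rat>. \<bar>(1 / real n) * (\<Sum>i=1..n. indicator {..x} (Y i)) - cdf \<nu> x\<bar>)" for Y
    unfolding KS_statistic_def
    by (intro SUP_rationals_right_continuous continuous_intros cdf_is_right_cont
        continuous_at_right_indicator_atMost bdd_above_KS_deviation \<nu>)
  moreover have bddQ: "bdd_above ((\<lambda>x. \<bar>(1 / real n) * (\<Sum>i=1..n. indicator {..x} (X i \<omega>)) - cdf \<nu> x\<bar>) ` \<rat>)" for \<omega>
    by (rule bdd_above_mono[OF bdd_above_KS_deviation[OF \<nu>, of n "\<lambda>i. X i \<omega>"]]) (intro image_mono subset_UNIV)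
  moreover have "(\<lambda>\<omega>. SUP x\<in>\<rat>. \<bar>(1 / real n) * (\<Sum>i=1..n. indicator {..x} (X i \<omega>)) - cdf \<nu> x\<bar>)
      \<in> borel_measurable M"
    by (intro borel_measurable_cSUP countable_rat borel_measurable_abs borel_measurable_diff
        borel_measurable_times borel_measurable_sum borel_measurable_const ind
        bddQ)
  ultimately show ?thesis by simp
qed

lemma KS_statistic_cong:
  assumes "\<And>i. i \<in> {1..n} \<Longrightarrow> X i = Y i"
  shows "KS_statistic \<nu> n X = KS_statistic \<nu> n Y"
proof -
  have "(\<Sum>i=1..n. indicator {..x} (X i) :: real) = (\<Sum>i=1..n. indicator {..x} (Y i))" for x
    by (rule sum.cong[OF refl]) (simp only: assms)
  then show ?thesis
    unfolding KS_statistic_def by (simp only:)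
qed

section \<open>The probability integral transform\<close>

abbreviation unif :: "real measure" where "unif \<equiv> uniform_measure lborel {0..1}"

lemma real_distribution_unif: "real_distribution unif"
proof -
  interpret prob_space unif by (rule prob_space_uniform_measure) auto
  show ?thesis by unfold_locales auto
qed

lemma cdf_unif: "cdf unif t = min 1 (max 0 t)"
proof -
  have "{0..1} \<inter> {..t} = {0..min 1 t}" by auto
  then show ?thesis
    by (simp add: cdf_def measure_uniform_measure)
qed

lemma surj_on_cdf:
  assumes \<nu>: "real_distribution \<nu>" and cont: "continuous_on UNIV (cdf \<nu>)" and t: "0 < t" "t < 1"
  obtains x where "cdf \<nu> x = t"
proof -
  interpret real_distribution \<nu> by fact
  obtain a where a: "cdf \<nu> a < t"
    using order_tendstoD(2)[OF cdf_lim_at_bot t(1)] by (auto simp: eventually_at_bot_linorder)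
  obtain b where b: "cdf \<nu> b > t"
    using order_tendstoD(1)[OF cdf_lim_at_top_prob t(2)] by (auto simp: eventually_at_top_linorder)
  have "a \<le> b"
    using a b cdf_nondecreasing[of b a] by linarith
  then have "\<exists>x\<ge>a. x \<le> b \<and> cdf \<nu> x = t"
    using a b by (intro IVT' continuous_on_subset[OF cont]) auto
  then show thesis using that by blast
qed

text \<open>The event \<open>cdf \<nu> Y \<le> t\<close> is caught between two events of the form \<open>Y \<le> x\<close>, which have probability
  \<open>cdf \<nu> x\<close>. By continuity \<open>x\<close> can be chosen to make this probability \<open>t\<close> (lower bound) or any \<open>s > t\<close>
  (upper bound). The strict inequality matters, since \<open>cdf \<nu>\<close> may be constant to the right of a point
  where it takes the value \<open>t\<close>.\<close>

lemma distr_cdf_eq_unif: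
  assumes \<nu>: "real_distribution \<nu>" and cont: "continuous_on UNIV (cdf \<nu>)"
  shows "distr \<nu> borel (cdf \<nu>) = unif"
proof (rule cdf_unique)
  interpret real_distribution \<nu> by fact
  have [measurable]: "cdf \<nu> \<in> borel_measurable borel"
    using cont by (rule borel_measurable_continuous_onI)
  show "real_distribution unif" by (rule real_distribution_unif)
  show "real_distribution (distr \<nu> borel (cdf \<nu>))"
    by (rule real_distribution_distr) simp
  then interpret D: real_distribution "distr \<nu> borel (cdf \<nu>)" .
  have D: "cdf (distr \<nu> borel (cdf \<nu>)) t = prob {x. cdf \<nu> x \<le> t}" for t
    unfolding cdf_def[of "distr \<nu> borel (cdf \<nu>)"] by (subst measure_distr) (auto simp: vimage_def)
  have mid_le: "cdf (distr \<nu> borel (cdf \<nu>)) t \<ge> t" if t: "0 < t" "t < 1" for t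
  proof -
    obtain x where x: "cdf \<nu> x = t" using surj_on_cdf[OF \<nu> cont t] .
    have "t = prob {..x}" using x by (simp add: cdf_def)
    also have "\<dots> \<le> prob {x. cdf \<nu> x \<le> t}"
      using x cdf_nondecreasing by (intro finite_measure_mono) auto
    finally show ?thesis by (simp add: D)
  qed
  have mid_ge: "cdf (distr \<nu> borel (cdf \<nu>)) t \<le> s" if t: "0 \<le> t" "t < s" "s < 1" for s t
  proof -
    obtain x where x: "cdf \<nu> x = s" using surj_on_cdf[OF \<nu> cont] t by (metis order_le_less_trans)
    have "y \<le> x" if "cdf \<nu> y \<le> t" for y
      using that x t cdf_nondecreasing[of x y] by (intro leI notI) linarith
    then have "prob {y. cdf \<nu> y \<le> t} \<le> prob {..x}"
      by (intro finite_measure_mono) auto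
    also have "\<dots> = s" using x by (simp add: cdf_def)
    finally show ?thesis by (simp add: D)
  qed
  show "cdf (distr \<nu> borel (cdf \<nu>)) = cdf unif"
  proof
    fix t :: real
    consider "t < 0" | "t \<ge> 1" | "0 \<le> t" "t < 1" by linarith
    then show "cdf (distr \<nu> borel (cdf \<nu>)) t = cdf unif t"
    proof cases
      case 1
      then have "{x. cdf \<nu> x \<le> t} = {}" using cdf_nonneg by (auto simp: not_le intro: less_le_trans)
      then show ?thesis using 1 by (simp add: D cdf_unif)
    next
      case 2
      then have "{x. cdf \<nu> x \<le> t} = UNIV" using cdf_bounded_prob by (auto intro: order_trans)
      then show ?thesis using 2 prob_space by (simp add: D cdf_unif)
    next
      case 3
      have "cdf (distr \<nu> borel (cdf \<nu>)) t \<le> t"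
        using 3 by (intro dense_ge_bounded[of t 1] mid_ge) auto
      moreover have "cdf (distr \<nu> borel (cdf \<nu>)) t \<ge> t"
        using 3 mid_le[of t] D.cdf_nonneg[of t] by (cases "t = 0") auto
      ultimately show ?thesis using 3 by (simp add: cdf_unif)
    qed
  qed
qed

section \<open>Kolmogorov's theorem: the law of the statistic is distribution-free\<close>

text \<open>For a fixed \<open>q\<close> the events \<open>y \<le> q\<close> and \<open>cdf \<nu> y \<le> cdf \<nu> q\<close> both have probability \<open>cdf \<nu> q\<close>, and the
  first is contained in the second, so they agree almost surely. To have this for all \<open>x\<close> outside of one
  null set, rational \<open>q\<close> suffice: if \<open>x < y\<close> but \<open>cdf \<nu> y \<le> cdf \<nu> x\<close>, any rational \<open>q\<close> between
  \<open>x\<close> and \<open>y\<close> is a witness as well.\<close>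

lemma AE_le_iff_cdf_le:
  assumes \<nu>: "real_distribution \<nu>" and cont: "continuous_on UNIV (cdf \<nu>)"
  shows "AE y in \<nu>. \<forall>x. y \<le> x \<longleftrightarrow> cdf \<nu> y \<le> cdf \<nu> x"
proof -
  interpret real_distribution \<nu> by fact
  have [measurable]: "cdf \<nu> \<in> borel_measurable borel"
    using cont by (rule borel_measurable_continuous_onI)
  have "AE y in \<nu>. cdf \<nu> y \<le> cdf \<nu> q \<longrightarrow> y \<le> q" for q
  proof -
    have "prob {y. cdf \<nu> y \<le> cdf \<nu> q} = cdf (distr \<nu> borel (cdf \<nu>)) (cdf \<nu> q)"
      unfolding cdf_def[of "distr \<nu> borel (cdf \<nu>)"] by (subst measure_distr) (auto simp: vimage_def)
    also have "\<dots> = prob {..q}"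
      using cdf_nonneg[of q] cdf_bounded_prob[of q]
      by (simp add: distr_cdf_eq_unif[OF assms] cdf_unif) (simp add: cdf_def)
    finally have "prob ({y. cdf \<nu> y \<le> cdf \<nu> q} - {..q}) = 0"
      using cdf_nondecreasing by (subst finite_measure_Diff) auto
    then have "emeasure \<nu> ({y. cdf \<nu> y \<le> cdf \<nu> q} - {..q}) = 0"
      by (simp add: emeasure_eq_measure)
    then show ?thesis
      by (intro AE_I[of _ _ "{y. cdf \<nu> y \<le> cdf \<nu> q} - {..q}"]) auto
  qed
  then have "AE y in \<nu>. \<forall>q\<in>\<rat>. cdf \<nu> y \<le> cdf \<nu> q \<longrightarrow> y \<le> q"
    by (intro AE_ball_countable' countable_rat)
  then show ?thesis
  proof eventually_elim
    case (elim y)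
    show ?case
    proof (intro allI iffI)
      fix x assume "cdf \<nu> y \<le> cdf \<nu> x"
      show "y \<le> x"
      proof (rule ccontr)
        assume "\<not> y \<le> x"
        then obtain q where q: "q \<in> \<rat>" "x < q" "q < y"
          using Rats_dense_in_real[of x y] by auto
        have "cdf \<nu> y \<le> cdf \<nu> q"
          using \<open>cdf \<nu> y \<le> cdf \<nu> x\<close> cdf_nondecreasing[of x q] q by linarith
        with elim q show False by auto
      qed
    qed (rule cdf_nondecreasing)
  qed
qed

lemma AE_cdf_pos:
  assumes \<nu>: "real_distribution \<nu>" and cont: "continuous_on UNIV (cdf \<nu>)"
  shows "AE y in \<nu>. 0 < cdf \<nu> y"
proof -
  interpret real_distribution \<nu> by fact
  have [measurable]: "cdf \<nu> \<in> borel_measurable borel"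
    using cont by (rule borel_measurable_continuous_onI)
  interpret D: real_distribution "distr \<nu> borel (cdf \<nu>)"
    by (rule real_distribution_distr) simp
  have "cdf (distr \<nu> borel (cdf \<nu>)) 0 = 0"
    by (simp add: distr_cdf_eq_unif[OF assms] cdf_unif)
  then have "measure (distr \<nu> borel (cdf \<nu>)) {..0} = 0"
    unfolding cdf_def[of "distr \<nu> borel (cdf \<nu>)"] .
  then have "AE u in distr \<nu> borel (cdf \<nu>). 0 < u"
    by (intro AE_I[of _ _ "{..0}"]) (auto simp: D.emeasure_eq_measure)
  then show ?thesis
    by (subst (asm) AE_distr_iff) auto
qed

lemma SUP_eq_SUP_UNIV_of_zero_outside:
  fixes h :: "'b \<Rightarrow> real"
  assumes bdd: "bdd_above (range h)" and nonneg: "\<And>t. 0 \<le> h t"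
    and A: "A \<noteq> {}" and zero: "\<And>t. t \<notin> A \<Longrightarrow> h t = 0"
  shows "(SUP t\<in>A. h t) = (SUP t. h t)"
proof (rule antisym)
  have bddA: "bdd_above (h ` A)"
    using bdd by (rule bdd_above_mono) auto
  show "(SUP t\<in>A. h t) \<le> (SUP t. h t)"
    using A bdd by (intro cSUP_mono) auto
  show "(SUP t. h t) \<le> (SUP t\<in>A. h t)"
  proof (rule cSUP_least)
    fix t
    show "h t \<le> (SUP t\<in>A. h t)"
    proof (cases "t \<in> A")
      case True
      then show ?thesis by (rule cSUP_upper[OF _ bddA])
    next
      case False
      obtain a where "a \<in> A" using A by blast
      have "h t = 0" using False by (rule zero)
      also have "0 \<le> h a" by (rule nonneg)
      also have "\<dots> \<le> (SUP t\<in>A. h t)" using \<open>a \<in> A\<close> by (rule cSUP_upper[OF _ bddA])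
      finally show ?thesis .
    qed
  qed simp
qed

text \<open>From \<open>1\<close> on, and below all sample points and \<open>0\<close>, the empirical and the uniform distribution function
  coincide. The boundary points \<open>0\<close> and \<open>1\<close> are treated here as well because they may lie outside of the
  range of a continuous distribution function; at \<open>0\<close> this is the reason for the strict \<open>t < U i\<close>.\<close>

lemma uniform_deviation_eq_0:
  assumes n: "n \<ge> 1" and le: "\<And>i. i \<in> {1..n} \<Longrightarrow> U i \<le> 1"
    and t: "1 \<le> t \<or> (t \<le> 0 \<and> (\<forall>i\<in>{1..n}. t < U i))"
  shows "\<bar>(1 / real n) * (\<Sum>i=1..n. indicator {..t} (U i)) - cdf unif t\<bar> = 0"
  using t
proof
  assume t: "1 \<le> t"
  then have "(\<Sum>i=1..n. indicator {..t} (U i) :: real) = (\<Sum>i=1..n. 1)"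
    by (intro sum.cong) (auto simp: indicator_def intro: order_trans[OF le])
  then show ?thesis using t n by (simp add: cdf_unif)
next
  assume t: "t \<le> 0 \<and> (\<forall>i\<in>{1..n}. t < U i)"
  then have "(\<Sum>i=1..n. indicator {..t} (U i) :: real) = 0"
    by (intro sum.neutral) (force simp: indicator_def)
  then show ?thesis using t by (simp add: cdf_unif)
qed

text \<open>The substitution \<open>t = cdf \<nu> x\<close> in the supremum. It reaches all \<open>t\<close> strictly between \<open>0\<close> and \<open>1\<close>, and the
  remaining \<open>t\<close> contribute \<open>0\<close>.\<close>

lemma KS_statistic_cdf_transform:
  assumes \<nu>: "real_distribution \<nu>" and cont: "continuous_on UNIV (cdf \<nu>)" and n: "n \<ge> 1"
    and iff: "\<And>i x. i \<in> {1..n} \<Longrightarrow> X i \<le> x \<longleftrightarrow> cdf \<nu> (X i) \<le> cdf \<nu> x"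
    and pos: "\<And>i. i \<in> {1..n} \<Longrightarrow> 0 < cdf \<nu> (X i)"
  shows "KS_statistic \<nu> n X = KS_statistic unif n (\<lambda>i. cdf \<nu> (X i))"
proof -
  interpret real_distribution \<nu> by fact
  define h where "h t = \<bar>(1 / real n) * (\<Sum>i=1..n. indicator {..t} (cdf \<nu> (X i))) - cdf unif t\<bar>" for t
  have bdd: "bdd_above (range h)"
    unfolding h_def by (rule bdd_above_KS_deviation[OF real_distribution_unif])
  have "\<bar>(1 / real n) * (\<Sum>i=1..n. indicator {..x} (X i)) - cdf \<nu> x\<bar> = h (cdf \<nu> x)" for x
  proof -
    have "(\<Sum>i=1..n. indicator {..x} (X i)) = (\<Sum>i=1..n. indicator {..cdf \<nu> x} (cdf \<nu> (X i)) :: real)"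
      using iff by (intro sum.cong) (auto simp: indicator_def)
    then show ?thesis
      using cdf_nonneg[of x] cdf_bounded_prob[of x] by (simp add: h_def cdf_unif)
  qed
  then have "KS_statistic \<nu> n X = (SUP x. h (cdf \<nu> x))"
    unfolding KS_statistic_def by simp
  also have "\<dots> = (SUP t\<in>range (cdf \<nu>). h t)"
    by (simp add: image_image)
  also have "\<dots> = (SUP t. h t)"
  proof (rule SUP_eq_SUP_UNIV_of_zero_outside[OF bdd])
    fix t assume "t \<notin> range (cdf \<nu>)"
    then have "t \<le> 0 \<or> 1 \<le> t"
      using surj_on_cdf[OF \<nu> cont, of t] by force
    then show "h t = 0"
      unfolding h_def using pos cdf_bounded_prob
      by (intro uniform_deviation_eq_0 n) (auto intro: le_less_trans)
  qed (auto simp: h_def)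
  also have "\<dots> = KS_statistic unif n (\<lambda>i. cdf \<nu> (X i))"
    unfolding KS_statistic_def h_def ..
  finally show ?thesis .
qed

lemma SUP_uniform_deviation_eq_KS_statistic:
  assumes n: "n \<ge> 1" and U: "\<And>i. i \<in> {1..n} \<Longrightarrow> 0 \<le> U i" "\<And>i. i \<in> {1..n} \<Longrightarrow> U i \<le> 1"
  shows "(SUP x\<in>{0..1}. \<bar>(1 / real n) * (\<Sum>i=1..n. indicator {0..x} (U i)) - x\<bar>) =
    KS_statistic unif n U"
proof -
  define h where "h t = \<bar>(1 / real n) * (\<Sum>i=1..n. indicator {..t} (U i)) - cdf unif t\<bar>" for t
  have bdd: "bdd_above (range h)"
    unfolding h_def by (rule bdd_above_KS_deviation[OF real_distribution_unif])
  have "\<bar>(1 / real n) * (\<Sum>i=1..n. indicator {0..x} (U i)) - x\<bar> = h x" if "x \<in> {0..1}" for x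
  proof -
    have "(\<Sum>i=1..n. indicator {0..x} (U i)) = (\<Sum>i=1..n. indicator {..x} (U i) :: real)"
      using U by (intro sum.cong) (auto simp: indicator_def)
    then show ?thesis using that by (simp add: h_def cdf_unif)
  qed
  then have "(SUP x\<in>{0..1}. \<bar>(1 / real n) * (\<Sum>i=1..n. indicator {0..x} (U i)) - x\<bar>) = (SUP x\<in>{0..1}. h x)"
    by (intro SUP_cong) auto
  also have "\<dots> = (SUP t. h t)"
  proof (rule SUP_eq_SUP_UNIV_of_zero_outside[OF bdd])
    fix t :: real assume "t \<notin> {0..1}"
    then have "t < 0 \<or> 1 \<le> t"
      by (cases "t < 0") auto
    then have "1 \<le> t \<or> (t \<le> 0 \<and> (\<forall>i\<in>{1..n}. t < U i))"
    proof
      assume "t < 0"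
      then have "\<forall>i\<in>{1..n}. t < U i" using U(1) by (blast intro: less_le_trans)
      with \<open>t < 0\<close> show ?thesis by simp
    qed simp
    with n U(2) show "h t = 0"
      unfolding h_def by (rule uniform_deviation_eq_0)
  qed (auto simp: h_def)
  also have "\<dots> = KS_statistic unif n U"
    unfolding KS_statistic_def h_def ..
  finally show ?thesis .
qed

lemma (in prob_space) distr_KS_statistic:
  assumes \<nu>: "real_distribution \<nu>" and n: "n \<ge> 1"
    and indep: "indep_vars (\<lambda>_. borel) X {1..n}"
    and law: "\<And>i. i \<in> {1..n} \<Longrightarrow> distr M borel (X i) = \<nu>"
  shows "distr M borel (\<lambda>\<omega>. KS_statistic \<nu> n (\<lambda>i. X i \<omega>)) = KS_law \<nu> n"
proof -
  interpret \<nu>: real_distribution \<nu> by fact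
  have rv: "random_variable borel (X i)" if "i \<in> {1..n}" for i
    using indep that unfolding indep_vars_def2 by blast
  have sample: "(\<lambda>\<omega>. \<lambda>i\<in>{1..n}. X i \<omega>) \<in> M \<rightarrow>\<^sub>M (\<Pi>\<^sub>M i\<in>{1..n}. borel)"
    by (intro measurable_restrict rv)
  have stat: "KS_statistic \<nu> n \<in> borel_measurable (\<Pi>\<^sub>M i\<in>{1..n}. borel)"
    by (rule borel_measurable_KS_statistic[OF \<nu>, of n "\<lambda>i y. y i"]) measurable
  have "distr M (\<Pi>\<^sub>M i\<in>{1..n}. borel) (\<lambda>\<omega>. \<lambda>i\<in>{1..n}. X i \<omega>) = (\<Pi>\<^sub>M i\<in>{1..n}. distr M borel (X i))"
    using indep n by (subst (asm) indep_vars_iff_distr_eq_PiM') (auto intro: rv)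
  also have "\<dots> = (\<Pi>\<^sub>M i\<in>{1..n}. \<nu>)"
    by (intro PiM_cong law refl)
  finally have joint: "(\<Pi>\<^sub>M i\<in>{1..n}. \<nu>) = distr M (\<Pi>\<^sub>M i\<in>{1..n}. borel) (\<lambda>\<omega>. \<lambda>i\<in>{1..n}. X i \<omega>)" ..
  have "KS_law \<nu> n = distr M borel (\<lambda>\<omega>. KS_statistic \<nu> n (\<lambda>i\<in>{1..n}. X i \<omega>))"
    unfolding KS_law_def joint by (subst distr_distr[OF stat sample]) (simp add: comp_def)
  also have "\<dots> = distr M borel (\<lambda>\<omega>. KS_statistic \<nu> n (\<lambda>i. X i \<omega>))"
    by (intro distr_cong refl KS_statistic_cong) simp
  finally show ?thesis ..
qed

text \<open>The coordinates of the product space form an independent sample from \<open>\<nu>\<close>. Applying \<open>cdf \<nu>\<close> to each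
  coordinate gives an independent uniform sample on the same space, with almost surely the
  same value of the statistic.\<close>

theorem KS_law_distribution_free:
  assumes \<nu>: "real_distribution \<nu>" and cont: "continuous_on UNIV (cdf \<nu>)" and n: "n \<ge> 1"
  shows "KS_law \<nu> n = KS_law unif n"
proof -
  interpret \<nu>: real_distribution \<nu> by fact
  interpret P: product_prob_space "\<lambda>_. \<nu>" "{1..n}" ..
  let ?P = "\<Pi>\<^sub>M i\<in>{1..n}. \<nu>"
  have [measurable]: "cdf \<nu> \<in> borel_measurable borel"
    using cont by (rule borel_measurable_continuous_onI)
  have [measurable]: "(\<lambda>y. y i) \<in> borel_measurable ?P" if "i \<in> {1..n}" for i
    using that by (metis \<nu>.events_eq_borel measurable_component_singleton measurable_cong_sets)
  have proj: "distr ?P \<nu> (\<lambda>y. y i) = \<nu>" if "i \<in> {1..n}" for i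
    using that by (intro distr_PiM_component) (rule \<nu>.prob_space_axioms)
  have "P.indep_vars (\<lambda>_. \<nu>) (\<lambda>i y. y i) {1..n}"
  proof (subst P.indep_vars_iff_distr_eq_PiM')
    have "distr ?P ?P (\<lambda>y. \<lambda>i\<in>{1..n}. y i) = distr ?P ?P (\<lambda>y. y)"
      by (intro distr_cong refl) (auto simp: space_PiM PiE_restrict)
    also have "\<dots> = (\<Pi>\<^sub>M i\<in>{1..n}. distr ?P \<nu> (\<lambda>y. y i))"
      unfolding distr_id2[OF refl] by (intro PiM_cong refl) (simp only: proj)
    finally show "distr ?P ?P (\<lambda>y. \<lambda>i\<in>{1..n}. y i) = (\<Pi>\<^sub>M i\<in>{1..n}. distr ?P \<nu> (\<lambda>y. y i))" .
  qed (use n in auto)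
  then have indep: "P.indep_vars (\<lambda>_. borel) (\<lambda>i y. cdf \<nu> (y i)) {1..n}"
    by (rule P.indep_vars_compose2) simp
  have law: "distr ?P borel (\<lambda>y. cdf \<nu> (y i)) = unif" if i: "i \<in> {1..n}" for i
  proof -
    have "distr ?P borel (\<lambda>y. cdf \<nu> (y i)) = distr (distr ?P \<nu> (\<lambda>y. y i)) borel (cdf \<nu>)"
      using i by (subst distr_distr) (auto simp: comp_def)
    then show ?thesis
      unfolding proj[OF i] distr_cdf_eq_unif[OF \<nu> cont] .
  qed
  have "AE y in ?P. KS_statistic \<nu> n y = KS_statistic unif n (\<lambda>i. cdf \<nu> (y i))"
  proof -
    have "AE y in ?P. \<forall>i\<in>{1..n}. (\<forall>x. y i \<le> x \<longleftrightarrow> cdf \<nu> (y i) \<le> cdf \<nu> x) \<and> 0 < cdf \<nu> (y i)"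
    proof (intro AE_ball_countable' countable_finite finite_atLeastAtMost)
      fix i assume i: "i \<in> {1..n}"
      have "AE z in \<nu>. (\<forall>x. z \<le> x \<longleftrightarrow> cdf \<nu> z \<le> cdf \<nu> x) \<and> 0 < cdf \<nu> z"
        using AE_le_iff_cdf_le[OF \<nu> cont] AE_cdf_pos[OF \<nu> cont] by eventually_elim blast
      then show "AE y in ?P. (\<forall>x. y i \<le> x \<longleftrightarrow> cdf \<nu> (y i) \<le> cdf \<nu> x) \<and> 0 < cdf \<nu> (y i)"
        by (rule AE_PiM_component[OF \<nu>.prob_space_axioms i])
    qed
    then show ?thesis
      by eventually_elim (rule KS_statistic_cdf_transform[OF \<nu> cont n]; blast)
  qed
  then have "KS_law \<nu> n = distr ?P borel (\<lambda>y. KS_statistic unif n (\<lambda>i. cdf \<nu> (y i)))"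
    unfolding KS_law_def
    by (intro distr_cong_AE refl borel_measurable_KS_statistic[OF \<nu>, of n "\<lambda>i y. y i"]
        borel_measurable_KS_statistic[OF real_distribution_unif]) measurable
  also have "\<dots> = KS_law unif n"
    by (rule P.distr_KS_statistic[OF real_distribution_unif n indep law])
  finally show ?thesis .
qed

section \<open>The conditional probability integral transform\<close>

text \<open>Rounding the second argument down to a multiple of \<open>1 / (k + 1)\<close> leaves only countably many values for
  it, so the rounded function is jointly measurable. It converges pointwise to \<open>F\<close> by continuity.\<close>

lemma borel_measurable_Caratheodory:
  fixes F :: "'b \<Rightarrow> real \<Rightarrow> real"
  assumes meas: "\<And>x. (\<lambda>u. F u x) \<in> borel_measurable N"
    and cont: "\<And>u. u \<in> space N \<Longrightarrow> continuous_on UNIV (F u)"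
  shows "(\<lambda>(u, x). F u x) \<in> borel_measurable (N \<Otimes>\<^sub>M borel)"
proof -
  define r where "r k x = real_of_int \<lfloor>real (Suc k) * x\<rfloor> / real (Suc k)" for k :: nat and x :: real
  have "(\<lambda>p. F (fst p) (r k (snd p))) \<in> borel_measurable (N \<Otimes>\<^sub>M borel)" for k
  proof -
    have "(\<lambda>p. F (fst p) (real_of_int j / real (Suc k))) \<in> borel_measurable (N \<Otimes>\<^sub>M borel)" for j :: int
      by (rule measurable_compose[OF measurable_fst meas])
    moreover have "(\<lambda>p. \<lfloor>real (Suc k) * snd p\<rfloor>) \<in> N \<Otimes>\<^sub>M borel \<rightarrow>\<^sub>M count_space UNIV"
      by measurable
    ultimately show ?thesis
      unfolding r_def by (rule measurable_compose_countable)
  qed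
  moreover have "(\<lambda>k. F (fst p) (r k (snd p))) \<longlonglongrightarrow> F (fst p) (snd p)" if "p \<in> space (N \<Otimes>\<^sub>M borel)" for p
  proof -
    have "(\<lambda>k. r k (snd p)) \<longlonglongrightarrow> snd p"
    proof (rule tendsto_sandwich)
      show "\<forall>\<^sub>F k in sequentially. snd p - 1 / real (Suc k) \<le> r k (snd p)"
      proof (intro always_eventually allI)
        fix k
        have "real (Suc k) * snd p - 1 \<le> real_of_int \<lfloor>real (Suc k) * snd p\<rfloor>" by linarith
        then have "(real (Suc k) * snd p - 1) / real (Suc k) \<le> r k (snd p)"
          unfolding r_def by (rule divide_right_mono) simp
        then show "snd p - 1 / real (Suc k) \<le> r k (snd p)" by (simp add: diff_divide_distrib)
      qed
      show "\<forall>\<^sub>F k in sequentially. r k (snd p) \<le> snd p"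
      proof (intro always_eventually allI)
        fix k
        have "r k (snd p) \<le> (real (Suc k) * snd p) / real (Suc k)"
          unfolding r_def by (rule divide_right_mono) auto
        then show "r k (snd p) \<le> snd p" by simp
      qed
      have "(\<lambda>k. snd p - 1 / real (Suc k)) \<longlonglongrightarrow> snd p - 0"
        by (intro tendsto_intros LIMSEQ_Suc lim_1_over_n)
      then show "(\<lambda>k. snd p - 1 / real (Suc k)) \<longlonglongrightarrow> snd p" by simp
    qed simp
    moreover have "isCont (F (fst p)) (snd p)"
      using cont[of "fst p"] that by (simp add: continuous_on_eq_continuous_at space_pair_measure mem_Times_iff)
    ultimately show ?thesis by (rule isCont_tendsto_compose[rotated])
  qed
  ultimately have "(\<lambda>p. F (fst p) (snd p)) \<in> borel_measurable (N \<Otimes>\<^sub>M borel)"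
    by (rule borel_measurable_LIMSEQ_real[rotated])
  then show ?thesis by (simp add: case_prod_beta')
qed

text \<open>The two-dimensional analogue of the fact that a distribution function determines its law. In the
  product order on pairs these rectangles are the sets \<open>{..c}\<close>, which are stable under intersection
  and generate the Borel sets.\<close>

lemma measure_eqI_atMost_rectangles:
  fixes P Q :: "(real \<times> real) measure"
  assumes "finite_measure P" and sets: "sets P = sets (borel \<Otimes>\<^sub>M borel)" "sets Q = sets (borel \<Otimes>\<^sub>M borel)"
    and eq: "\<And>a b. emeasure P ({..a} \<times> {..b}) = emeasure Q ({..a} \<times> {..b})"
  shows "P = Q"
proof -
  interpret finite_measure P by fact
  have rect: "{..c} = {..fst c} \<times> {..snd c}" for c :: "real \<times> real"
    by (auto simp: less_eq_prod_def)
  have gen: "sets (borel :: (real \<times> real) measure) = sigma_sets UNIV (range (\<lambda>c. {..c}))"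
    by (subst borel_eq_atMost) simp
  show ?thesis
  proof (rule measure_eqI_generator_eq[where E = "range (\<lambda>c :: real \<times> real. {..c})"
        and \<Omega> = UNIV and A = "\<lambda>k. {..(real k, real k)}"])
    show "Int_stable (range (\<lambda>c :: real \<times> real. {..c}))"
    proof (rule Int_stableI)
      fix A B assume "A \<in> range (\<lambda>c :: real \<times> real. {..c})" "B \<in> range (\<lambda>c :: real \<times> real. {..c})"
      then obtain c d :: "real \<times> real" where "A = {..c}" "B = {..d}" by blast
      then have "A \<inter> B = {..inf c d}" by auto
      then show "A \<inter> B \<in> range (\<lambda>c. {..c})" by simp
    qed
    show "sets P = sigma_sets UNIV (range (\<lambda>c. {..c}))" "sets Q = sigma_sets UNIV (range (\<lambda>c. {..c}))"
      unfolding sets borel_prod by (rule gen)+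
    show "(\<Union>k. {..(real k, real k)}) = UNIV"
    proof (intro set_eqI iffI UNIV_I)
      fix c :: "real \<times> real"
      obtain k where "max (fst c) (snd c) \<le> real k" using real_arch_simple by blast
      then show "c \<in> (\<Union>k. {..(real k, real k)})" by (auto simp: rect mem_Times_iff)
    qed
    show "emeasure P X = emeasure Q X" if "X \<in> range (\<lambda>c. {..c})" for X
      using that eq by (auto simp only: rect)
  qed auto
qed

text \<open>The defining property of the conditional expectation, tested on the event \<open>Z \<in> A\<close>.\<close>

lemma (in prob_space) prob_le_eq_integral_conditional_cdf:
  fixes X Z :: "'a \<Rightarrow> real"
  assumes [measurable]: "random_variable borel X" "random_variable borel Z" "G \<in> borel_measurable borel"
    and A: "A \<in> sets borel"
    and null: "AE \<omega> in M. real_cond_exp M (vimage_algebra (space M) Z borel)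
        (indicator {\<omega> \<in> space M. X \<omega> \<le> x}) \<omega> = G (Z \<omega>)"
  shows "prob {\<omega> \<in> space M. Z \<omega> \<in> A \<and> X \<omega> \<le> x} = (\<integral>\<omega>. indicator A (Z \<omega>) * G (Z \<omega>) \<partial>M)"
proof -
  let ?\<sigma> = "vimage_algebra (space M) Z borel"
  have sub: "subalgebra M ?\<sigma>"
    unfolding subalgebra_def by (auto simp: sets_vimage_algebra2)
  interpret S: sigma_finite_subalgebra M ?\<sigma>
    by (intro finite_measure_subalgebra_is_sigma_finite)
      (simp add: finite_measure_subalgebra_def finite_measure_subalgebra_axioms_def sub finite_measure_axioms)
  have [measurable]: "real_cond_exp M ?\<sigma> (indicator {\<omega> \<in> space M. X \<omega> \<le> x}) \<in> borel_measurable M"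
    by (rule borel_measurable_cond_exp2)
  have A': "Z -` A \<inter> space M \<in> sets ?\<sigma>"
    using A by (auto simp: sets_vimage_algebra2)
  have [measurable]: "A \<in> sets borel" by fact
  have "prob {\<omega> \<in> space M. Z \<omega> \<in> A \<and> X \<omega> \<le> x} =
      (\<integral>\<omega>. indicator {\<omega> \<in> space M. Z \<omega> \<in> A \<and> X \<omega> \<le> x} \<omega> \<partial>M)"
    by (simp add: Int_absorb2 subset_eq)
  also have "\<dots> = (\<integral>\<omega>\<in>Z -` A \<inter> space M. indicator {\<omega> \<in> space M. X \<omega> \<le> x} \<omega> \<partial>M)"
    unfolding set_lebesgue_integral_def
    by (intro Bochner_Integration.integral_cong) (auto simp: indicator_def)
  also have "\<dots> = (\<integral>\<omega>\<in>Z -` A \<inter> space M. real_cond_exp M ?\<sigma> (indicator {\<omega> \<in> space M. X \<omega> \<le> x}) \<omega> \<partial>M)"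
    by (intro S.real_cond_exp_intA A') (auto simp: emeasure_eq_measure)
  also have "\<dots> = (\<integral>\<omega>. indicator A (Z \<omega>) * G (Z \<omega>) \<partial>M)"
    unfolding set_lebesgue_integral_def
  proof (rule integral_cong_AE)
    show "AE \<omega> in M. indicator (Z -` A \<inter> space M) \<omega> *\<^sub>R
        real_cond_exp M ?\<sigma> (indicator {\<omega> \<in> space M. X \<omega> \<le> x}) \<omega> = indicator A (Z \<omega>) * G (Z \<omega>)"
      using null AE_space by eventually_elim (auto simp: indicator_def)
  qed measurable
  finally show ?thesis .
qed

text \<open>The distributions \<open>\<kappa> u\<close> with distribution function \<open>F u\<close> form a Markov kernel, and the null hypothesis says
  exactly that the joint law of \<open>Z\<close> and \<open>X\<close> is the law of \<open>Z\<close> followed by this kernel. The image of \<open>\<kappa> u\<close>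
  under \<open>F u\<close> is uniform, whatever \<open>u\<close> is, so that integrating out \<open>u\<close> changes nothing.\<close>

lemma (in prob_space) conditional_probability_integral_transform:
  fixes X Z :: "'a \<Rightarrow> real" and F :: "real \<Rightarrow> real \<Rightarrow> real"
  assumes X[measurable]: "random_variable borel X" and Z[measurable]: "random_variable borel Z"
    and F_cdf: "\<And>u. \<exists>\<mu>. real_distribution \<mu> \<and> cdf \<mu> = F u"
    and F_meas[measurable]: "\<And>x. (\<lambda>u. F u x) \<in> borel_measurable borel"
    and F_cont: "\<And>u. continuous_on UNIV (F u)"
    and null: "\<And>x. AE \<omega> in M. real_cond_exp M (vimage_algebra (space M) Z borel)
        (indicator {\<omega> \<in> space M. X \<omega> \<le> x}) \<omega> = F (Z \<omega>) x"
  shows "distr M borel (\<lambda>\<omega>. F (Z \<omega>) (X \<omega>)) = unif"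
proof -
  obtain \<kappa> where "\<forall>u. real_distribution (\<kappa> u) \<and> cdf (\<kappa> u) = F u"
    using F_cdf by metis
  then have \<kappa>: "real_distribution (\<kappa> u)" and cdf_\<kappa>: "cdf (\<kappa> u) = F u" for u
    by auto
  interpret \<kappa>: real_distribution "\<kappa> u" for u by (rule \<kappa>)
  have em: "emeasure (\<kappa> u) {..x} = ennreal (F u x)" for u x
    unfolding cdf_\<kappa>[symmetric] cdf_def by (rule \<kappa>.emeasure_eq_measure)
  have F01: "0 \<le> F u x" "F u x \<le> 1" for u x
    unfolding cdf_\<kappa>[symmetric] by (rule \<kappa>.cdf_nonneg, rule \<kappa>.cdf_bounded_prob)
  have joint_meas[measurable]: "(\<lambda>(u, x). F u x) \<in> borel_measurable (borel \<Otimes>\<^sub>M borel)"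
    by (rule borel_measurable_Caratheodory[OF F_meas F_cont])
  have F_meas2[measurable]: "F u \<in> borel_measurable borel" for u
    using F_cont by (rule borel_measurable_continuous_onI)
  let ?L = "distr M borel Z" and ?BB = "borel \<Otimes>\<^sub>M borel :: (real \<times> real) measure"
  interpret L: prob_space ?L by (rule prob_space_distr) measurable
  have \<kappa>_meas[measurable]: "\<kappa> \<in> borel \<rightarrow>\<^sub>M prob_algebra borel"
  proof (rule measurable_prob_algebra_generated)
    show "sets borel = sigma_sets UNIV (range (\<lambda>x :: real. {..x}))"
      by (subst borel_eq_atMost) simp
    show "Int_stable (range (\<lambda>x :: real. {..x}))"
      by (auto simp: Int_stable_def)
  qed (auto simp: em \<kappa>.prob_space_axioms)
  \<comment> \<open>\<open>K u\<close> is the joint law of the pair, given that its first component is \<open>u\<close>.\<close>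
  define K where "K u = distr (\<kappa> u) ?BB (Pair u)" for u
  have K: "K \<in> borel \<rightarrow>\<^sub>M prob_algebra ?BB"
    unfolding K_def by measurable
  have K': "K \<in> ?L \<rightarrow>\<^sub>M subprob_algebra ?BB"
    using measurable_prob_algebraD[OF K] by simp
  have joint: "distr M ?BB (\<lambda>\<omega>. (Z \<omega>, X \<omega>)) = ?L \<bind> K"
  proof (rule measure_eqI_atMost_rectangles)
    show "finite_measure (distr M ?BB (\<lambda>\<omega>. (Z \<omega>, X \<omega>)))"
      by (intro prob_space.finite_measure prob_space_distr) measurable
    show "sets (?L \<bind> K) = sets ?BB"
      by (rule sets_bind_measurable[OF K']) simp
    fix a b :: real
    have "emeasure (?L \<bind> K) ({..a} \<times> {..b}) = (\<integral>\<^sup>+u. emeasure (K u) ({..a} \<times> {..b}) \<partial>?L)"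
      by (rule emeasure_bind[OF _ K']) auto
    also have "\<dots> = (\<integral>\<^sup>+u. ennreal (indicator {..a} u * F u b) \<partial>?L)"
    proof (rule nn_integral_cong)
      fix u :: real
      have "emeasure (K u) ({..a} \<times> {..b}) = emeasure (\<kappa> u) (Pair u -` ({..a} \<times> {..b}))"
        unfolding K_def by (subst emeasure_distr) auto
      also have "Pair u -` ({..a} \<times> {..b}) = (if u \<le> a then {..b} else {})"
        by auto
      finally show "emeasure (K u) ({..a} \<times> {..b}) = ennreal (indicator {..a} u * F u b)"
        by (simp add: em)
    qed
    also have "\<dots> = (\<integral>\<^sup>+\<omega>. ennreal (indicator {..a} (Z \<omega>) * F (Z \<omega>) b) \<partial>M)"
      by (rule nn_integral_distr) measurable
    also have "\<dots> = ennreal (\<integral>\<omega>. indicator {..a} (Z \<omega>) * F (Z \<omega>) b \<partial>M)"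
      using F01 by (intro nn_integral_eq_integral integrable_const_bound[where B = 1])
        (auto simp: indicator_def)
    also have "\<dots> = ennreal (prob {\<omega> \<in> space M. Z \<omega> \<in> {..a} \<and> X \<omega> \<le> b})"
      by (subst prob_le_eq_integral_conditional_cdf[OF X Z F_meas _ null]) auto
    also have "\<dots> = emeasure (distr M ?BB (\<lambda>\<omega>. (Z \<omega>, X \<omega>))) ({..a} \<times> {..b})"
      by (subst emeasure_distr) (auto simp: emeasure_eq_measure intro!: arg_cong[where f = prob])
    finally show "emeasure (distr M ?BB (\<lambda>\<omega>. (Z \<omega>, X \<omega>))) ({..a} \<times> {..b}) =
        emeasure (?L \<bind> K) ({..a} \<times> {..b})" ..
  qed simp
  have "distr M borel (\<lambda>\<omega>. F (Z \<omega>) (X \<omega>)) =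
      distr (distr M ?BB (\<lambda>\<omega>. (Z \<omega>, X \<omega>))) borel (\<lambda>(u, x). F u x)"
    by (subst distr_distr) (auto simp: comp_def)
  also have "\<dots> = ?L \<bind> (\<lambda>u. distr (K u) borel (\<lambda>(u, x). F u x))"
    unfolding joint by (rule distr_bind[OF K']) auto
  also have "\<dots> = ?L \<bind> (\<lambda>u. unif)"
  proof (intro bind_cong refl)
    fix u
    have "distr (K u) borel (\<lambda>(u, x). F u x) = distr (\<kappa> u) borel (F u)"
      unfolding K_def by (subst distr_distr) (auto simp: comp_def)
    also have "\<dots> = unif"
      using distr_cdf_eq_unif[OF \<kappa>, of u] F_cont[of u] by (simp add: cdf_\<kappa>)
    finally show "distr (K u) borel (\<lambda>(u, x). F u x) = unif" .
  qed
  also have "\<dots> = unif"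
    using real_distribution_unif
    by (intro bind_const' L.prob_space_axioms prob_space_imp_subprob_space) (simp add: real_distribution_def)
  finally show ?thesis .
qed

section \<open>The conditional Kolmogorov-Smirnov statistic\<close>

theorem theorem3p2:
  fixes M :: "'a measure" and n :: nat
    and \<xi> \<zeta> :: "nat \<Rightarrow> 'a \<Rightarrow> real"
    and F :: "real \<Rightarrow> real \<Rightarrow> real"
  assumes prob: "prob_space M"
    and n: "n \<ge> 1"
    and indep: "prob_space.indep_vars M (\<lambda>_. borel \<Otimes>\<^sub>M borel) (\<lambda>i \<omega>. (\<xi> i \<omega>, \<zeta> i \<omega>)) {1..n}"
    and ident: "\<And>i j. i \<in> {1..n} \<Longrightarrow> j \<in> {1..n} \<Longrightarrow>
      distr M (borel \<Otimes>\<^sub>M borel) (\<lambda>\<omega>. (\<xi> i \<omega>, \<zeta> i \<omega>)) =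
      distr M (borel \<Otimes>\<^sub>M borel) (\<lambda>\<omega>. (\<xi> j \<omega>, \<zeta> j \<omega>))"
    and F_cdf: "\<And>u. \<exists>\<mu>. real_distribution \<mu> \<and> cdf \<mu> = F u"
    and F_meas: "\<And>x. (\<lambda>u. F u x) \<in> borel_measurable borel"
    and F_cont: "\<And>u. continuous_on UNIV (F u)"
    and null: "\<And>i x. i \<in> {1..n} \<Longrightarrow>
      (AE \<omega> in M. real_cond_exp M (vimage_algebra (space M) (\<zeta> i) borel)
        (indicator {\<omega> \<in> space M. \<xi> i \<omega> \<le> x}) \<omega> = F (\<zeta> i \<omega>) x)"
  shows "KS_distributed M n
    (\<lambda>\<omega>. SUP x\<in>{0..1}. \<bar>(1 / real n) * (\<Sum>i=1..n. indicator {0..x} (F (\<zeta> i \<omega>) (\<xi> i \<omega>))) - x\<bar>)"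
proof -
  interpret prob_space M by (rule prob)
  let ?U = "\<lambda>i \<omega>. F (\<zeta> i \<omega>) (\<xi> i \<omega>)"
  have pair: "(\<lambda>\<omega>. (\<xi> i \<omega>, \<zeta> i \<omega>)) \<in> M \<rightarrow>\<^sub>M borel \<Otimes>\<^sub>M borel" if "i \<in> {1..n}" for i
    using indep that unfolding indep_vars_def2 by blast
  have \<xi>: "random_variable borel (\<xi> i)" and \<zeta>: "random_variable borel (\<zeta> i)" if "i \<in> {1..n}" for i
    using measurable_compose[OF pair[OF that] measurable_fst]
      measurable_compose[OF pair[OF that] measurable_snd] by simp_all
  have [measurable]: "(\<lambda>(u, x). F u x) \<in> borel_measurable (borel \<Otimes>\<^sub>M borel)"
    by (rule borel_measurable_Caratheodory[OF F_meas F_cont])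
  have "indep_vars (\<lambda>_. borel) (\<lambda>i \<omega>. (\<lambda>(x, u). F u x) (\<xi> i \<omega>, \<zeta> i \<omega>)) {1..n}"
    by (rule indep_vars_compose2[OF indep]) measurable
  then have U_indep: "indep_vars (\<lambda>_. borel) ?U {1..n}"
    by simp
  have U_law: "distr M borel (?U i) = unif" if "i \<in> {1..n}" for i
    by (intro conditional_probability_integral_transform \<xi> \<zeta> F_cdf F_meas F_cont null that)
  have F01: "0 \<le> F u x \<and> F u x \<le> 1" for u x
  proof -
    obtain \<mu> where \<mu>: "real_distribution \<mu>" "cdf \<mu> = F u" using F_cdf by blast
    show ?thesis
      unfolding \<mu>(2)[symmetric]
      using real_distribution.cdf_bounded_prob[OF \<mu>(1)]
        finite_borel_measure.cdf_nonneg[OF real_distribution.finite_borel_measure_M[OF \<mu>(1)]]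
      by blast
  qed
  have S: "(SUP x\<in>{0..1}. \<bar>(1 / real n) * (\<Sum>i=1..n. indicator {0..x} (?U i \<omega>)) - x\<bar>) =
      KS_statistic unif n (\<lambda>i. ?U i \<omega>)" for \<omega>
    by (rule SUP_uniform_deviation_eq_KS_statistic[OF n]) (use F01 in auto)
  have "(\<lambda>\<omega>. KS_statistic unif n (\<lambda>i. ?U i \<omega>)) \<in> borel_measurable M"
    using U_indep unfolding indep_vars_def2
    by (intro borel_measurable_KS_statistic real_distribution_unif) blast
  moreover have "distr M borel (\<lambda>\<omega>. KS_statistic unif n (\<lambda>i. ?U i \<omega>)) = KS_law unif n"
    by (rule distr_KS_statistic[OF real_distribution_unif n U_indep U_law])
  ultimately show ?thesis
    unfolding KS_distributed_def S using KS_law_distribution_free[OF _ _ n] by auto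
qed

end
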